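(* Let $d, n \geq 1$, let $I = (i_1, \ldots, i_n) \in \{1,\ldots,d\}^n$ be a multi-index, let $x \in C_1([0,1], \mathbb{R}^d)$ and let $y \in C_1([0,1], \mathbb{R}^n)$ be the linear path $y_t = t\,\mathbf{e}$, where $\mathbf{e} = e_1 + \cdots + e_n$ and $e_1,\ldots,e_n$ is the standard basis of $\mathbb{R}^n$. Then, with $\lambda = (\lambda_1,\ldots,\lambda_n) \in \mathbb{R}^n$, $$\frac{\partial^n}{\partial \lambda_1 \cdots \partial \lambda_n} \mathbf{k}_{x^I,\, \lambda \odot y} \Big|_{\lambda = 0} = \frac{1}{n!}\, S(x)^{\mathcal{P}(I)}.$$
   Context: $C_1([0,1],\mathbb{R}^k)$ is the space of continuous paths $[0,1]\to\mathbb{R}^k$ of finite 1-variation. For $x \in C_1([0,1],\mathbb{R}^k)$ with components $x = (x^{(1)},\ldots,x^{(k)})$ and a multi-index $J = (j_1,\ldots,j_m) \in \{1,\ldots,k\}^m$, the signature coefficient is the iterated integral $S(x)^J = \int_{0<t_1<\cdots<t_m<1} dx^{(j_1)}_{t_1}\cdots dx^{(j_m)}_{t_m}$, with $S(x)^{\emptyset} = 1$ for the empty multi-index ($m=0$). For two paths $x,y$ of the same dimension $k$, the signature kernel is $\mathbf{k}_{x,y} = \langle S(x), S(y)\rangle = \sum_{m=0}^\infty \sum_{J \in \{1,\ldots,k\}^m} S(x)^J S(y)^J$. For $x \in C_1([0,1],\mathbb{R}^d)$ and $I = (i_1,\ldots,i_n) \in \{1,\ldots,d\}^n$, $x^I \in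 C_1([0,1],\mathbb{R}^n)$ is the path with components $(x^{(i_1)},\ldots,x^{(i_n)})$. For $\lambda \in \mathbb{R}^n$ and an $n$-dimensional path $z$, $\lambda \odot z$ is the path with components $(\lambda_1 z^{(1)},\ldots,\lambda_n z^{(n)})$. For a multi-index $J$, $\mathcal{P}(J)$ denotes the set of multi-indices which are permutations of $J$; for example $\mathcal{P}(1,2,2) = \{(1,2,2),(2,1,2),(2,2,1)\}$. For a set $\mathcal{I}$ of multi-indices, $S(x)^{\mathcal{I}} = \sum_{J\in\mathcal{I}} S(x)^J$.
   Formalization: Since P(I) is a set, the printed formula fails when I has repeated entries (e.g. I=(1,1), x_t=t: 1/2 versus 1/4); the right-hand side is multiplied by the product of the factorials of the multiplicities of the entries of I, which is 1 when the entries are distinct. *)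

theory Defs
  imports "HOL-Analysis.Analysis" "HOL-Combinatorics.Multiset_Permutations"
begin

text \<open>A path in \<open>\<real>\<^sup>k\<close> is a function \<^typ>\<open>real \<Rightarrow> real ^ 'k\<close>, of which only the values on \<open>[0,1]\<close>
  are used; multi-indices over \<open>{1,\<dots>,k}\<close> are lists over the finite index type.\<close>

definition finite_1_variation :: "(real \<Rightarrow> 'a::real_normed_vector) \<Rightarrow> bool" where
  "finite_1_variation x \<longleftrightarrow>
     (\<exists>B. \<forall>(N::nat) t.
        (\<forall>i\<le>N. t i \<in> {0..1}) \<and> (\<forall>i<N. t i \<le> t (Suc i)) \<longrightarrow>
        (\<Sum>i<N. norm (x (t (Suc i)) - x (t i))) \<le> B)"

definition C1_path :: "(real \<Rightarrow> real ^ 'k::finite) \<Rightarrow> bool" where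
  "C1_path x \<longleftrightarrow> continuous_on {0..1} x \<and> finite_1_variation x"

text \<open>Riemann--Stieltjes integral of \<open>f\<close> against \<open>g\<close> over \<open>[a,b]\<close>. A tagged division that is fine
  for the constant gauge \<open>\<lambda>s. ball s \<delta>\<close> is one whose mesh is controlled by \<open>\<delta>\<close>.\<close>

definition has_rs_integral ::
    "(real \<Rightarrow> real) \<Rightarrow> (real \<Rightarrow> real) \<Rightarrow> real \<Rightarrow> real \<Rightarrow> real \<Rightarrow> bool" where
  "has_rs_integral f g a b L \<longleftrightarrow>
     (\<forall>\<epsilon>>0. \<exists>\<delta>>0. \<forall>p. p tagged_division_of {a..b} \<and> (\<lambda>s. ball s \<delta>) fine p \<longrightarrow>
        \<bar>(\<Sum>(s, K)\<in>p. f s * (g (Sup K) - g (Inf K))) - L\<bar> < \<epsilon>)"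

lemma has_rs_integral_unique:
  assumes "has_rs_integral f g a b L" "has_rs_integral f g a b M"
  shows "L = M"
proof (rule ccontr)
  assume "L \<noteq> M"
  then have e: "\<bar>L - M\<bar> / 2 > 0" by simp
  obtain c where c: "c > 0" "\<And>p. p tagged_division_of {a..b} \<Longrightarrow> (\<lambda>s. ball s c) fine p \<Longrightarrow>
        \<bar>(\<Sum>(s, K)\<in>p. f s * (g (Sup K) - g (Inf K))) - L\<bar> < \<bar>L - M\<bar> / 2"
    using assms(1) e unfolding has_rs_integral_def by meson
  obtain d where d: "d > 0" "\<And>p. p tagged_division_of {a..b} \<Longrightarrow> (\<lambda>s. ball s d) fine p \<Longrightarrow>
        \<bar>(\<Sum>(s, K)\<in>p. f s * (g (Sup K) - g (Inf K))) - M\<bar> < \<bar>L - M\<bar> / 2"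
    using assms(2) e unfolding has_rs_integral_def by meson
  have "gauge (\<lambda>s::real. ball s (min c d))"
    using c(1) d(1) by (simp add: gauge_ball)
  then obtain p where p: "p tagged_division_of cbox a b" "(\<lambda>s. ball s (min c d)) fine p"
    using fine_division_exists_real[of _ a b] by (metis box_real(2))
  have "(\<lambda>s. ball s c) fine p" "(\<lambda>s. ball s d) fine p"
    using p(2) unfolding fine_def by (auto simp: subset_iff)
  with c(2)[of p] d(2)[of p] p(1) show False
    by (simp add: box_real) (smt (verit) field_sum_of_halves)
qed

definition rs_integral :: "(real \<Rightarrow> real) \<Rightarrow> (real \<Rightarrow> real) \<Rightarrow> real \<Rightarrow> real \<Rightarrow> real" where
  "rs_integral f g a b = (THE L. has_rs_integral f g a b L)"

text \<open>\<open>iter_int x [j\<^sub>m, \<dots>, j\<^sub>1] t\<close> is the integral of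
  \<open>dx\<^bsup>(j\<^sub>1)\<^esup>\<^bsub>t\<^sub>1\<^esub> \<dots> dx\<^bsup>(j\<^sub>m)\<^esup>\<^bsub>t\<^sub>m\<^esub>\<close> over \<open>0 < t\<^sub>1 < \<dots> < t\<^sub>m < t\<close>: the head of the list belongs to
  the outermost variable, hence the reversal in \<open>sig\<close>.\<close>

primrec iter_int :: "(real \<Rightarrow> real ^ 'k::finite) \<Rightarrow> 'k list \<Rightarrow> real \<Rightarrow> real" where
  "iter_int x [] = (\<lambda>t. 1)"
| "iter_int x (j # js) = (\<lambda>t. rs_integral (iter_int x js) (\<lambda>s. x s $ j) 0 t)"

definition sig :: "(real \<Rightarrow> real ^ 'k::finite) \<Rightarrow> 'k list \<Rightarrow> real" where
  "sig x J = iter_int x (rev J) 1"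

definition sig_set :: "(real \<Rightarrow> real ^ 'k::finite) \<Rightarrow> 'k list set \<Rightarrow> real" where
  "sig_set x \<I> = (\<Sum>J\<in>\<I>. sig x J)"

definition sig_kernel :: "(real \<Rightarrow> real ^ 'k::finite) \<Rightarrow> (real \<Rightarrow> real ^ 'k) \<Rightarrow> real" where
  "sig_kernel x y = (\<Sum>m. \<Sum>J | length J = m. sig x J * sig y J)"

definition coord_path :: "(real \<Rightarrow> real ^ 'd::finite) \<Rightarrow> ('n::finite \<Rightarrow> 'd) \<Rightarrow> real \<Rightarrow> real ^ 'n" where
  "coord_path x I = (\<lambda>t. \<chi> k. x t $ I k)"

definition scale_path :: "real ^ 'n::finite \<Rightarrow> (real \<Rightarrow> real ^ 'n) \<Rightarrow> real \<Rightarrow> real ^ 'n" where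
  "scale_path l z = (\<lambda>t. \<chi> k. l $ k * z t $ k)"

text \<open>The tuple \<open>(I\<^sub>1, \<dots>, I\<^sub>n)\<close>, where the index type, listed in increasing order, plays the role
  of \<open>{1,\<dots>,n}\<close>. Its permutations form the set \<open>permutations_of_multiset (mset (tuple I))\<close>. Each
  element of this set is counted once; if \<open>I\<close> has repeated entries, it arises from several
  permutations of the positions, namely from the product of the factorials of the multiplicities.\<close>

definition tuple :: "('n::{finite,linorder} \<Rightarrow> 'd) \<Rightarrow> 'd list" where
  "tuple I = map I (sorted_list_of_set UNIV)"

text \<open>\<open>has_iterated_partial f [k\<^sub>1, \<dots>, k\<^sub>r] D a\<close>: the iterated partial derivative
  \<open>\<partial>\<^bsub>k\<^sub>1\<^esub>(\<partial>\<^bsub>k\<^sub>2\<^esub>(\<dots> \<partial>\<^bsub>k\<^sub>r\<^esub> f))\<close> exists at \<open>a\<close>, the inner ones existing in a neighbourhood, and is \<open>D\<close>.\<close>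

primrec has_iterated_partial ::
    "(real ^ 'n::finite \<Rightarrow> real) \<Rightarrow> 'n list \<Rightarrow> real \<Rightarrow> real ^ 'n \<Rightarrow> bool" where
  "has_iterated_partial f [] = (\<lambda>D a. D = f a)"
| "has_iterated_partial f (k # ks) = (\<lambda>D a.
     \<exists>g. (\<forall>\<^sub>F l in nhds a. has_iterated_partial f ks (g l) l) \<and>
         ((\<lambda>h. g (a + h *\<^sub>R axis k 1)) has_real_derivative D) (at 0))"

lemma has_iterated_partial_unique:
  assumes "has_iterated_partial f ks D a" "has_iterated_partial f ks E a"
  shows "D = E"
  using assms
proof (induction ks arbitrary: D E a)
  case (Cons k ks)
  obtain g where g: "\<forall>\<^sub>F l in nhds a. has_iterated_partial f ks (g l) l"
      "((\<lambda>h. g (a + h *\<^sub>R axis k 1)) has_real_derivative D) (at 0)"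
    using Cons.prems(1) by auto
  obtain g' where g': "\<forall>\<^sub>F l in nhds a. has_iterated_partial f ks (g' l) l"
      "((\<lambda>h. g' (a + h *\<^sub>R axis k 1)) has_real_derivative E) (at 0)"
    using Cons.prems(2) by auto
  have ev: "\<forall>\<^sub>F l in nhds a. g l = g' l"
    using g(1) g'(1) by eventually_elim (rule Cons.IH)
  have "((\<lambda>h. a + h *\<^sub>R axis k 1) \<longlongrightarrow> a + 0 *\<^sub>R axis k 1) (nhds (0::real))"
    by (intro tendsto_intros) (rule filterlim_ident)
  then have "filterlim (\<lambda>h. a + h *\<^sub>R axis k 1) (nhds a) (nhds (0::real))"
    by simp
  then have "\<forall>\<^sub>F h in nhds (0::real). g (a + h *\<^sub>R axis k 1) = g' (a + h *\<^sub>R axis k 1)"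
    by (rule eventually_compose_filterlim[OF ev])
  then have "((\<lambda>h. g' (a + h *\<^sub>R axis k 1)) has_real_derivative D) (at 0)"
    using g(2) by (subst (asm) DERIV_cong_ev) auto
  then show ?case using g'(2) DERIV_unique by blast
qed simp

end

theory Submission
  imports Defs
begin

text \<open>By homogeneity \<open>S(\<lambda> \<odot> y)\<^sup>J = (\<Prod>j\<in>J. \<lambda>\<^sub>j) / |J|!\<close>, so the kernel is a power series in \<open>\<lambda>\<close> whose
  coefficients \<open>S(x\<^sup>I)\<^sup>J / |J|!\<close> are dominated by \<open>B\<^bsup>|J|\<^esup> / |J|!\<close>. It may therefore be differentiated term
  by term, and the mixed derivative at \<open>0\<close> only retains the multilinear monomials, that is the
  arrangements \<open>J\<close> of the \<open>n\<close> positions. A permutation of the tuple \<open>I\<close> arises from as many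
  arrangements of the positions as the product of the factorials of the multiplicities.\<close>

section \<open>Bounds for iterated integrals\<close>

text \<open>\<open>W\<close> is the total variation function of \<open>x\<close>: a chain of points
  in \<open>[0,u]\<close>, prolonged by \<open>u\<close> and \<open>v\<close>, is a chain in
  \<open>[0,v]\<close>. Differences of \<open>W\<close> telescope over a division, which the
  estimate of Riemann sums relies on.\<close>

lemma variation_majorant:
  fixes x :: "real \<Rightarrow> 'a::real_normed_vector"
  assumes "finite_1_variation x"
  obtains W where "\<And>u v. 0 \<le> u \<Longrightarrow> u \<le> v \<Longrightarrow> v \<le> 1 \<Longrightarrow> norm (x v - x u) \<le> W v - W u"
proof -
  obtain B where B: "\<And>(N::nat) t. (\<forall>i\<le>N. t i \<in> {0..1}) \<Longrightarrow> (\<forall>i<N. t i \<le> t (Suc i)) \<Longrightarrow>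
      (\<Sum>i<N. norm (x (t (Suc i)) - x (t i))) \<le> B"
    using assms unfolding finite_1_variation_def by blast
  define S where "S = (\<lambda>r. {\<Sum>i<N. norm (x (t (Suc i)) - x (t i)) | N t.
      (\<forall>i\<le>N::nat. t i \<in> {0..r}) \<and> (\<forall>i<N. t i \<le> t (Suc i))})"
  have "norm (x v - x u) \<le> Sup (S v) - Sup (S u)" if uv: "0 \<le> u" "u \<le> v" "v \<le> 1" for u v
  proof -
    have bdd: "bdd_above (S v)"
    proof (rule bdd_aboveI[of _ B])
      fix r assume "r \<in> S v"
      then show "r \<le> B" unfolding S_def using uv by (force intro!: B)
    qed
    have ne: "S u \<noteq> {}"
    proof -
      \<comment> \<open>The chain without steps, \<open>N = 0\<close>, contributes the empty
        sum.\<close>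
      have "(\<Sum>i<0. norm (x ((\<lambda>_. 0) (Suc i)) - x ((\<lambda>_. 0) i))) \<in> S u"
        unfolding S_def using uv by (intro CollectI exI[of _ "0::nat"] exI[of _ "\<lambda>_. 0"]) auto
      then show ?thesis by blast
    qed
    have "Sup (S u) \<le> Sup (S v) - norm (x v - x u)"
    proof (rule cSup_least[OF ne])
      fix r assume "r \<in> S u"
      then obtain N t where N: "r = (\<Sum>i<N. norm (x (t (Suc i)) - x (t i)))"
        "\<forall>i\<le>N. t i \<in> {0..u}" "\<forall>i<N. t i \<le> t (Suc i)"
        unfolding S_def by blast
      \<comment> \<open>The last point \<open>t N\<close> may lie below \<open>u\<close>, so
        \<open>u\<close> is inserted before \<open>v\<close>; the extra term
        \<open>norm (x u - x (t N))\<close> is nonnegative and is discarded at the end.\<close>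
      define t' where "t' = (\<lambda>i. if i \<le> N then t i else if i = Suc N then u else v)"
      have "(\<Sum>i<Suc (Suc N). norm (x (t' (Suc i)) - x (t' i))) \<in> S v"
        unfolding S_def
      proof (intro CollectI exI[of _ "Suc (Suc N)"] exI[of _ t'] conjI refl allI impI)
        fix i assume "i \<le> Suc (Suc N)"
        then show "t' i \<in> {0..v}" using N(2) uv unfolding t'_def by fastforce
      next
        fix i assume "i < Suc (Suc N)"
        then consider "i < N" | "i = N" | "i = Suc N" by linarith
        then show "t' i \<le> t' (Suc i)" using N(2,3) uv unfolding t'_def by cases auto
      qed
      then have "(\<Sum>i<Suc (Suc N). norm (x (t' (Suc i)) - x (t' i))) \<le> Sup (S v)"
        by (rule cSup_upper[OF _ bdd])
      moreover have "(\<Sum>i<N. norm (x (t' (Suc i)) - x (t' i))) = r"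
        unfolding N(1) by (rule sum.cong) (auto simp: t'_def)
      ultimately have "r + norm (x u - x (t N)) + norm (x v - x u) \<le> Sup (S v)"
        by (simp add: t'_def)
      then show "r \<le> Sup (S v) - norm (x v - x u)"
        using norm_ge_zero[of "x u - x (t N)"] by linarith
    qed
    then show ?thesis by linarith
  qed
  then show ?thesis by (rule that)
qed

lemma tagged_division_of_real_interval:
  fixes a b :: real
  assumes "p tagged_division_of {a..b}" "(s, K) \<in> p"
  shows "a \<le> Inf K" "Inf K \<le> s" "s \<le> Sup K" "Sup K \<le> b" "K = {Inf K..Sup K}"
proof -
  obtain c d where K: "K = {c..d}"
    using tagged_division_ofD(4)[OF assms] by (auto simp: box_real)
  have "s \<in> K" "K \<subseteq> {a..b}"
    using tagged_division_ofD(2,3)[OF assms] by auto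
  then show "a \<le> Inf K" "Inf K \<le> s" "s \<le> Sup K" "Sup K \<le> b" "K = {Inf K..Sup K}"
    unfolding K by auto
qed

text \<open>A Riemann sum is dominated cell by cell by \<open>M\<close> times the increments of
  \<open>W\<close>, and these telescope. A sufficiently fine division carries the bound over to
  \<open>L\<close> up to \<open>e\<close>.\<close>

lemma has_rs_integral_bound:
  assumes L: "has_rs_integral f g a b L" and "a \<le> b"
    and f: "\<And>s. a \<le> s \<Longrightarrow> s \<le> b \<Longrightarrow> \<bar>f s\<bar> \<le> M"
    and g: "\<And>u v. a \<le> u \<Longrightarrow> u \<le> v \<Longrightarrow> v \<le> b \<Longrightarrow> \<bar>g v - g u\<bar> \<le> W v - W u"
  shows "\<bar>L\<bar> \<le> M * (W b - W a)"
proof (rule field_le_epsilon)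
  fix e :: real assume "0 < e"
  then obtain d where d: "d > 0" "\<And>p. p tagged_division_of {a..b} \<Longrightarrow> (\<lambda>s. ball s d) fine p \<Longrightarrow>
        \<bar>(\<Sum>(s, K)\<in>p. f s * (g (Sup K) - g (Inf K))) - L\<bar> < e"
    using L unfolding has_rs_integral_def by meson
  have "gauge (\<lambda>s::real. ball s d)"
    using d(1) by (simp add: gauge_ball)
  then obtain p where p: "p tagged_division_of {a..b}" "(\<lambda>s. ball s d) fine p"
    using fine_division_exists_real[of _ a b] by metis
  have "M \<ge> 0" using f[of a] \<open>a \<le> b\<close> by force
  have "\<bar>\<Sum>(s, K)\<in>p. f s * (g (Sup K) - g (Inf K))\<bar> \<le> (\<Sum>(s, K)\<in>p. M * (W (Sup K) - W (Inf K)))"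
  proof (rule order_trans[OF sum_abs], rule sum_mono, clarify)
    fix s K assume sK: "(s, K) \<in> p"
    note tagged_division_of_real_interval(1-4)[OF p(1) sK]
    then show "\<bar>f s * (g (Sup K) - g (Inf K))\<bar> \<le> M * (W (Sup K) - W (Inf K))"
      unfolding abs_mult using \<open>M \<ge> 0\<close> by (intro mult_mono f g) auto
  qed
  also have "\<dots> = M * (W b - W a)"
    using additive_tagged_division_1[OF \<open>a \<le> b\<close> p(1), of W]
    by (simp add: split_def flip: sum_distrib_left)
  finally show "\<bar>L\<bar> \<le> M * (W b - W a) + e"
    using d(2)[OF p] by linarith
qed

lemma rs_integral_eq: "has_rs_integral f g a b L \<Longrightarrow> rs_integral f g a b = L"
  unfolding rs_integral_def by (rule the_equality) (auto intro: has_rs_integral_unique)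

text \<open>\<^const>\<open>rs_integral\<close> takes one and the same junk value whenever the integral does not exist.
  Including that value in the bound makes the existence of the integrals irrelevant.\<close>

lemma iter_int_bound:
  fixes x :: "real \<Rightarrow> real ^ 'k::finite"
  assumes "finite_1_variation x"
  obtains B where "B \<ge> 0" "\<And>js t. 0 \<le> t \<Longrightarrow> t \<le> 1 \<Longrightarrow> \<bar>iter_int x js t\<bar> \<le> B ^ length js"
proof -
  obtain W where W: "\<And>u v. 0 \<le> u \<Longrightarrow> u \<le> v \<Longrightarrow> v \<le> 1 \<Longrightarrow> norm (x v - x u) \<le> W v - W u"
    using variation_majorant[OF assms] by blast
  \<comment> \<open>\<open>c\<close> is the junk value: if no \<open>L\<close> qualifies, the
    predicate under \<open>THE\<close> is constantly \<open>False\<close>. The summand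
    \<open>1\<close> in \<open>B\<close> gives \<open>B \<ge> 1\<close>, so that
    \<open>\<bar>c\<bar> \<le> B\<close> stays below every positive power of
    \<open>B\<close>.\<close>
  define c where "c = (THE L::real. False)"
  define B where "B = 1 + \<bar>c\<bar> + (W 1 - W 0)"
  have W01: "0 \<le> W 1 - W 0"
    using order_trans[OF norm_ge_zero W[of 0 1]] by simp
  then have B: "B \<ge> 1" "\<bar>c\<bar> \<le> B" "W 1 - W 0 \<le> B" unfolding B_def by auto
  have "\<bar>iter_int x js t\<bar> \<le> B ^ length js" if "0 \<le> t" "t \<le> 1" for js t
    using that
  proof (induction js arbitrary: t)
    case (Cons j js)
    show ?case
    proof (cases "\<exists>L. has_rs_integral (iter_int x js) (\<lambda>s. x s $ j) 0 t L")
      case True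
      then obtain L where L: "has_rs_integral (iter_int x js) (\<lambda>s. x s $ j) 0 t L" by blast
      have "\<bar>L\<bar> \<le> B ^ length js * (W t - W 0)"
      proof (rule has_rs_integral_bound[OF L \<open>0 \<le> t\<close>])
        fix u v assume "0 \<le> u" "u \<le> v" "v \<le> t"
        then have "norm (x v - x u) \<le> W v - W u" using W Cons.prems by auto
        then show "\<bar>x v $ j - x u $ j\<bar> \<le> W v - W u"
          using component_le_norm_cart[of "x v - x u" j] by simp
      qed (use Cons in auto)
      also have "\<dots> \<le> B ^ length js * B"
      proof (rule mult_left_mono)
        have "0 \<le> norm (x 1 - x t)" by simp
        also have "\<dots> \<le> W 1 - W t" using W Cons.prems by simp
        finally show "W t - W 0 \<le> B" using B by linarith
      qed (use B in auto)
      finally show ?thesis using rs_integral_eq[OF L] by (simp add: mult.commute)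
    next
      case False
      then have "has_rs_integral (iter_int x js) (\<lambda>s. x s $ j) 0 t = (\<lambda>_. False)" by blast
      then have "iter_int x (j # js) t = c" by (simp add: rs_integral_def c_def)
      moreover have "B \<le> B ^ length (j # js)"
        using B by (intro self_le_power) auto
      ultimately show ?thesis using B(2) by linarith
    qed
  qed simp
  moreover have "B \<ge> 0" using B by simp
  ultimately show ?thesis by (rule that[rotated])
qed

section \<open>Signatures of the paths in the kernel\<close>

text \<open>On each cell the mean value theorem turns the increment of \<open>F\<close> into
  \<open>f t\<close> times the length of the cell; uniform continuity of \<open>f\<close> then
  exchanges \<open>t\<close> for the tag.\<close>

lemma has_rs_integral_antiderivative:
  assumes "a \<le> b"
    and F: "\<And>s. a \<le> s \<Longrightarrow> s \<le> b \<Longrightarrow> (F has_real_derivative f s) (at s within {a..b})"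
    and f: "continuous_on {a..b} f"
  shows "has_rs_integral f (\<lambda>s. s) a b (F b - F a)"
  unfolding has_rs_integral_def
proof (intro allI impI)
  fix e :: real assume "0 < e"
  \<comment> \<open>The \<open>1 +\<close> in the denominator covers \<open>a = b\<close> and makes
    \<open>e' * (b - a) < e\<close> strict.\<close>
  define e' where "e' = e / (1 + (b - a))"
  have e': "e' > 0" "e' * (b - a) < e"
    using \<open>0 < e\<close> \<open>a \<le> b\<close> by (simp_all add: e'_def field_simps)
  have "uniformly_continuous_on {a..b} f"
    using f by (rule compact_uniformly_continuous) simp
  then obtain d where d: "d > 0" "\<And>s s'. s \<in> {a..b} \<Longrightarrow> s' \<in> {a..b} \<Longrightarrow> dist s' s < d \<Longrightarrow> dist (f s') (f s) < e'"
    unfolding uniformly_continuous_on_def using e'(1) by meson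
  show "\<exists>\<delta>>0. \<forall>p. p tagged_division_of {a..b} \<and> (\<lambda>s. ball s \<delta>) fine p \<longrightarrow>
           \<bar>(\<Sum>(s, K)\<in>p. f s * (Sup K - Inf K)) - (F b - F a)\<bar> < e"
  proof (intro exI[of _ d] conjI allI impI, fact)
    fix p assume "p tagged_division_of {a..b} \<and> (\<lambda>s. ball s d) fine p"
    then have p: "p tagged_division_of {a..b}" "(\<lambda>s. ball s d) fine p" by auto
    have "\<bar>\<Sum>(s, K)\<in>p. f s * (Sup K - Inf K) - (F (Sup K) - F (Inf K))\<bar>
        \<le> (\<Sum>(s, K)\<in>p. e' * (Sup K - Inf K))"
    proof (rule order_trans[OF sum_abs], rule sum_mono, clarify)
      fix s K assume sK: "(s, K) \<in> p"
      note K = tagged_division_of_real_interval[OF p(1) sK]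
      have "K \<subseteq> ball s d" using p(2) sK unfolding fine_def by auto
      show "\<bar>f s * (Sup K - Inf K) - (F (Sup K) - F (Inf K))\<bar> \<le> e' * (Sup K - Inf K)"
      proof (cases "Inf K < Sup K")
        case True
        have "(F has_derivative (\<lambda>h. f t * h)) (at t within {Inf K..Sup K})"
          if "Inf K \<le> t" "t \<le> Sup K" for t
          using F[of t] that K(1,4) unfolding has_field_derivative_def
          by (auto intro: has_derivative_subset)
        then obtain t where t: "t \<in> {Inf K<..<Sup K}" "F (Sup K) - F (Inf K) = f t * (Sup K - Inf K)"
          using mvt_simple[OF True, of F "\<lambda>t h. f t * h"] by blast
        have "t \<in> K" using t(1) K(5) by force
        then have "dist t s < d" using \<open>K \<subseteq> ball s d\<close> by (auto simp: dist_commute)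
        then have "\<bar>f s - f t\<bar> \<le> e'"
          using d(2)[of s t] t(1) K(1-4) by (simp add: dist_real_def abs_minus_commute)
        then have "\<bar>f s - f t\<bar> * (Sup K - Inf K) \<le> e' * (Sup K - Inf K)"
          using True by (intro mult_right_mono) auto
        moreover have "f s * (Sup K - Inf K) - (F (Sup K) - F (Inf K)) = (f s - f t) * (Sup K - Inf K)"
          unfolding t(2) by (simp add: algebra_simps)
        ultimately show ?thesis using True by (simp add: abs_mult)
      next
        \<comment> \<open>A tagged division may contain one-point cells, on which the mean value
          theorem says nothing.\<close>
        case False
        then have "Inf K = Sup K" using K(2,3) by linarith
        then show ?thesis by simp
      qed
    qed
    also have "\<dots> = e' * (b - a)"
      using additive_tagged_division_1[OF \<open>a \<le> b\<close> p(1), of "\<lambda>s. s"]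
      by (simp add: split_def flip: sum_distrib_left)
    also have "(\<Sum>(s, K)\<in>p. f s * (Sup K - Inf K) - (F (Sup K) - F (Inf K)))
        = (\<Sum>(s, K)\<in>p. f s * (Sup K - Inf K)) - (F b - F a)"
      using additive_tagged_division_1[OF \<open>a \<le> b\<close> p(1), of F]
      by (simp add: sum_subtractf split_def)
    finally show "\<bar>(\<Sum>(s, K)\<in>p. f s * (Sup K - Inf K)) - (F b - F a)\<bar> < e"
      using e'(2) by linarith
  qed
qed

text \<open>Tags and endpoints of cells lie in \<open>[a,b]\<close>, so values elsewhere never enter
  a Riemann sum. This allows for paths that are known only on \<open>[0,1]\<close>.\<close>

lemma has_rs_integral_cong:
  assumes "\<And>s. a \<le> s \<Longrightarrow> s \<le> b \<Longrightarrow> f s = f' s"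
    and "\<And>s. a \<le> s \<Longrightarrow> s \<le> b \<Longrightarrow> g s = g' s"
  shows "has_rs_integral f g a b L \<longleftrightarrow> has_rs_integral f' g' a b L"
proof -
  have "(\<Sum>(s, K)\<in>p. f s * (g (Sup K) - g (Inf K))) = (\<Sum>(s, K)\<in>p. f' s * (g' (Sup K) - g' (Inf K)))"
    if "p tagged_division_of {a..b}" for p
  proof (rule sum.cong[OF refl], clarify)
    fix s K assume "(s, K) \<in> p"
    note tagged_division_of_real_interval(1-4)[OF that this]
    then show "f s * (g (Sup K) - g (Inf K)) = f' s * (g' (Sup K) - g' (Inf K))"
      using assms(1)[of s] assms(2)[of "Sup K"] assms(2)[of "Inf K"] by simp
  qed
  then have "(p tagged_division_of {a..b} \<and> (\<lambda>s. ball s \<delta>) fine p \<longrightarrow>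
        \<bar>(\<Sum>(s, K)\<in>p. f s * (g (Sup K) - g (Inf K))) - L\<bar> < \<epsilon>) \<longleftrightarrow>
      (p tagged_division_of {a..b} \<and> (\<lambda>s. ball s \<delta>) fine p \<longrightarrow>
        \<bar>(\<Sum>(s, K)\<in>p. f' s * (g' (Sup K) - g' (Inf K))) - L\<bar> < \<epsilon>)" for p \<delta> \<epsilon>
    by (intro imp_cong refl) (simp only:)
  then show ?thesis unfolding has_rs_integral_def by (simp only:)
qed

lemma has_rs_integral_scale_integrator:
  assumes "has_rs_integral (\<lambda>s. c * f s) g a b L"
  shows "has_rs_integral f (\<lambda>s. c * g s) a b L"
  using assms unfolding has_rs_integral_def by (simp add: algebra_simps)

text \<open>The product of the slopes times the volume of the simplex. Each induction step evaluates
  the outermost integral through the antiderivative of a monomial.\<close>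

lemma iter_int_linear:
  fixes z :: "real \<Rightarrow> real ^ 'n::finite"
  assumes z: "\<And>s k. 0 \<le> s \<Longrightarrow> s \<le> 1 \<Longrightarrow> z s $ k = l $ k * s" and "0 \<le> t" "t \<le> 1"
  shows "iter_int z js t = prod_list (map (($) l) js) * t ^ length js / fact (length js)"
  using assms(2,3)
proof (induction js arbitrary: t)
  case (Cons j js)
  define m where "m = length js"
  define P where "P = prod_list (map (($) l) js)"
  \<comment> \<open>The antiderivative of the next integrand; it vanishes at \<open>0\<close>
    because its exponent is positive.\<close>
  define F where "F = (\<lambda>s::real. l $ j * P / fact (Suc m) * s ^ Suc m)"
  have "has_rs_integral (\<lambda>s. l $ j * (P * s ^ m / fact m)) (\<lambda>s. s) 0 t (F t - F 0)"
  proof (rule has_rs_integral_antiderivative[OF \<open>0 \<le> t\<close>])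
    fix s :: real
    have "l $ j * (P * s ^ m / fact m) = l $ j * P / fact (Suc m) * (real (Suc m) * s ^ (Suc m - Suc 0))"
      by (simp add: field_simps del: of_nat_Suc)
    then show "(F has_real_derivative l $ j * (P * s ^ m / fact m)) (at s within {0..t})"
      unfolding F_def by (simp only: DERIV_cmult DERIV_pow)
  qed (intro continuous_intros, simp)
  then have "has_rs_integral (\<lambda>s. P * s ^ m / fact m) (\<lambda>s. l $ j * s) 0 t (F t - F 0)"
    by (rule has_rs_integral_scale_integrator)
  also have "?this \<longleftrightarrow> has_rs_integral (iter_int z js) (\<lambda>s. z s $ j) 0 t (F t - F 0)"
    using Cons z by (intro has_rs_integral_cong) (auto simp: P_def m_def)
  finally have "iter_int z (j # js) t = F t - F 0"
    by (simp add: rs_integral_eq)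
  then show ?case by (simp add: F_def P_def m_def)
qed simp

text \<open>On \<open>[0,1]\<close> every component of \<open>y\<close> is \<open>t\<close>, so the
  scaled path has slopes \<open>l $ k\<close>. The reversal in \<open>sig\<close> is harmless
  because the product commutes.\<close>

lemma sig_scale_linear:
  fixes y :: "real \<Rightarrow> real ^ 'n::finite"
  assumes "\<forall>t\<in>{0..1}. y t = t *\<^sub>R (\<Sum>k\<in>UNIV. axis k 1)"
  shows "sig (scale_path l y) J = prod_list (map (($) l) J) / fact (length J)"
proof -
  have "scale_path l y s $ k = l $ k * s" if "0 \<le> s" "s \<le> 1" for s k
    using assms that by (simp add: scale_path_def axis_def)
  then show ?thesis
    unfolding sig_def
    by (subst iter_int_linear) (auto simp: rev_map[symmetric])
qed

lemma iter_int_coord_path: "iter_int (coord_path x I) js = iter_int x (map I js)"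
  by (induction js) (auto simp: coord_path_def)

lemma sig_coord_path: "sig (coord_path x I) J = sig x (map I J)"
  by (simp add: sig_def iter_int_coord_path rev_map)

section \<open>Termwise mixed derivatives\<close>

text \<open>\<open>mixed_monom K c\<close> is the monomial with exponents \<open>c\<close>, differentiated once in each variable of \<open>K\<close>.\<close>

definition mixed_monom :: "'n set \<Rightarrow> ('n \<Rightarrow> nat) \<Rightarrow> real ^ 'n::finite \<Rightarrow> real" where
  "mixed_monom K c l = (\<Prod>k\<in>UNIV. if k \<in> K then real (c k) * (l $ k) ^ (c k - 1) else (l $ k) ^ c k)"

text \<open>For empty \<open>K\<close> and suitable \<open>w\<close> this is the kernel as a
  function of the scaling vector; other \<open>K\<close> give its termwise derivatives. Grouping by
  length mirrors \<open>sig_kernel\<close>, so no series has to be rearranged.\<close>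

definition mixed_series :: "('n list \<Rightarrow> real) \<Rightarrow> 'n set \<Rightarrow> real ^ 'n::finite \<Rightarrow> real" where
  "mixed_series w K l = (\<Sum>m. \<Sum>J | length J = m. w J * mixed_monom K (count_list J) l)"

lemma finite_lists_length: "finite {J :: 'n::finite list. length J = m}"
  and card_lists_length: "card {J :: 'n list. length J = m} = CARD('n) ^ m"
  using finite_lists_length_eq[of "UNIV :: 'n set" m] card_lists_length_eq[of "UNIV :: 'n set" m] by auto

lemma sum_count_list_UNIV: "(\<Sum>k\<in>UNIV. count_list J k) = length (J :: 'n::finite list)"
  by (rule sum_count_set) auto

lemma mixed_monom_empty:
  "mixed_monom {} (count_list J) l = prod_list (map (($) l) J)"
proof -
  have "(\<Prod>k\<in>UNIV. (l $ k) ^ count_list J k) = prod_list (map (($) l) J)"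
  proof (induction J)
    case (Cons j J)
    have "(\<Prod>k\<in>UNIV. (l $ k) ^ count_list (j # J) k)
        = (\<Prod>k\<in>UNIV. (if k = j then l $ k else 1) * (l $ k) ^ count_list J k)"
      by (rule prod.cong) auto
    then show ?case using Cons by (simp add: prod.distrib)
  qed simp
  then show ?thesis by (simp add: mixed_monom_def)
qed

text \<open>\<open>c \<le> 2 ^ c\<close> absorbs the factor produced by a derivative,
  \<open>R \<ge> 1\<close> absorbs the lowered exponent, and the exponents add up to
  \<open>length J\<close>. As the bound is the same for all \<open>K\<close>, one majorant serves
  the series and its derivatives.\<close>

lemma mixed_monom_bound:
  assumes "R \<ge> 1" "\<And>k. \<bar>l $ k\<bar> \<le> R"
  shows "\<bar>mixed_monom K (count_list J) l\<bar> \<le> (2 * R) ^ length J"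
proof -
  have "\<bar>if k \<in> K then real c * (l $ k) ^ (c - 1) else (l $ k) ^ c\<bar> \<le> (2 * R) ^ c" for k c
  proof -
    have le: "\<bar>l $ k\<bar> ^ i \<le> R ^ c" if "i \<le> c" for i
      using power_mono[OF assms(2), of k i] power_increasing[OF that assms(1)] by simp
    have "real c * \<bar>l $ k\<bar> ^ (c - 1) \<le> 2 ^ c * R ^ c"
      using le[of "c - 1"] of_nat_less_two_power[of c, where 'a = real] by (intro mult_mono) auto
    moreover have "1 * \<bar>l $ k\<bar> ^ c \<le> 2 ^ c * R ^ c"
      using le[of c] by (intro mult_mono) auto
    ultimately show ?thesis by (simp add: abs_mult power_abs power_mult_distrib)
  qed
  then have "\<bar>mixed_monom K (count_list J) l\<bar> \<le> (\<Prod>k\<in>UNIV. (2 * R) ^ count_list J k)"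
    unfolding mixed_monom_def abs_prod by (intro prod_mono) auto
  then show ?thesis unfolding power_sum[symmetric] sum_count_list_UNIV .
qed

text \<open>Along \<open>axis k 1\<close> only the factor of \<open>k\<close> varies, and for
  \<open>k \<notin> K\<close> this factor is still a plain power.\<close>

lemma mixed_monom_derivative:
  assumes "k \<notin> K"
  shows "((\<lambda>h. mixed_monom K c (l + h *\<^sub>R axis k 1)) has_real_derivative
           mixed_monom (insert k K) c (l + h *\<^sub>R axis k 1)) (at h within S)"
proof -
  define p where "p = (\<lambda>K i r. if i \<in> K then real (c i) * r ^ (c i - 1) else r ^ c i)"
  define P where "P = (\<Prod>i\<in>UNIV - {k}. p K i (l $ i))"
  have component: "(l + h *\<^sub>R axis k 1) $ i = (if i = k then l $ k + h else l $ i)" for h i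
    by (simp add: axis_def)
  \<comment> \<open>The condition \<open>K' - {k} = K\<close> admits both \<open>K\<close> and
    \<open>insert k K\<close>, so the two monomials share the constant \<open>P\<close>.\<close>
  have monom: "mixed_monom K' c (l + h *\<^sub>R axis k 1) = p K' k (l $ k + h) * P" if "K' - {k} = K" for K' h
  proof -
    have "mixed_monom K' c (l + h *\<^sub>R axis k 1) = (\<Prod>i\<in>UNIV. p K' i (if i = k then l $ k + h else l $ i))"
      by (simp only: mixed_monom_def p_def component)
    also have "\<dots> = p K' k (l $ k + h) * (\<Prod>i\<in>UNIV - {k}. p K' i (if i = k then l $ k + h else l $ i))"
      by (simp add: prod.remove[of UNIV k])
    also have "(\<Prod>i\<in>UNIV - {k}. p K' i (if i = k then l $ k + h else l $ i)) = P"
      unfolding P_def by (rule prod.cong) (use that in \<open>auto simp: p_def\<close>)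
    finally show ?thesis .
  qed
  have "((\<lambda>h. (l $ k + h) ^ c k * P) has_real_derivative real (c k) * (l $ k + h) ^ (c k - 1) * P) (at h within S)"
    by (auto intro!: derivative_eq_intros)
  then show ?thesis
    using assms by (simp add: monom p_def)
qed

text \<open>For \<open>\<bar>h\<bar> < 1\<close> the block of words of length \<open>m\<close> is at
  most \<open>Q ^ m / fact m\<close>, a term of an exponential series. The Weierstrass test makes
  the differentiated series converge uniformly, which permits termwise differentiation.\<close>

lemma mixed_series_derivative:
  fixes w :: "'n::finite list \<Rightarrow> real"
  assumes w: "\<And>J. \<bar>w J\<bar> \<le> B ^ length J / fact (length J)" and "B \<ge> 0" and "k \<notin> K"
  shows "((\<lambda>h. mixed_series w K (l + h *\<^sub>R axis k 1)) has_real_derivative mixed_series w (insert k K) l) (at 0)"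
proof -
  define T where "T = (\<lambda>K m h. \<Sum>J | length J = m. w J * mixed_monom K (count_list J) (l + h *\<^sub>R axis k 1))"
  \<comment> \<open>\<open>R\<close> bounds the coordinates of
    \<open>l + h *\<^sub>R axis k 1\<close>. In \<open>Q\<close>, the number of words supplies
    \<open>CARD('n)\<close>, the coefficients \<open>B\<close>, and the monomials
    \<open>2 * R\<close>.\<close>
  define R where "R = 2 + norm l"
  define Q where "Q = real CARD('n) * (B * (2 * R))"
  have bound: "\<bar>T K m h\<bar> \<le> Q ^ m / fact m" if "h \<in> ball 0 1" for K m h
  proof -
    have R: "\<bar>(l + h *\<^sub>R axis k 1) $ i\<bar> \<le> R" for i
      using component_le_norm_cart[of l i] that unfolding R_def by (auto simp: axis_def)
    have "\<bar>T K m h\<bar> \<le> (\<Sum>J | length (J :: 'n list) = m. B ^ m / fact m * (2 * R) ^ m)"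
      unfolding T_def
    proof (rule order_trans[OF sum_abs], rule sum_mono)
      fix J :: "'n list" assume "J \<in> {J. length J = m}"
      then have J: "length J = m" by simp
      have "\<bar>mixed_monom K (count_list J) (l + h *\<^sub>R axis k 1)\<bar> \<le> (2 * R) ^ m"
        unfolding J[symmetric] by (rule mixed_monom_bound[OF _ R]) (simp add: R_def)
      then show "\<bar>w J * mixed_monom K (count_list J) (l + h *\<^sub>R axis k 1)\<bar> \<le> B ^ m / fact m * (2 * R) ^ m"
        unfolding abs_mult using w[of J] \<open>B \<ge> 0\<close> J by (intro mult_mono) auto
    qed
    also have "\<dots> = Q ^ m / fact m"
      by (simp add: card_lists_length Q_def power_mult_distrib)
    finally show ?thesis .
  qed
  have summable: "summable (\<lambda>m. Q ^ m / fact m)"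
    using summable_exp[of Q] by (simp add: divide_inverse mult.commute)
  have "((\<lambda>h. \<Sum>m. T K m h) has_field_derivative (\<Sum>m. T (insert k K) m 0)) (at 0)"
  proof (rule has_field_derivative_series'(2)[where S = "ball 0 1" and f = "T K" and f' = "T (insert k K)"])
    show "uniformly_convergent_on (ball 0 1) (\<lambda>n h. \<Sum>m<n. T (insert k K) m h)"
      using bound summable by (intro Weierstrass_m_test'[where M = "\<lambda>m. Q ^ m / fact m"]) auto
    show "summable (\<lambda>m. T K m 0)"
      using bound summable by (intro summable_comparison_test'[OF summable, of 0]) auto
    show "(T K m has_field_derivative T (insert k K) m h) (at h within ball 0 1)" for m h
      unfolding T_def by (intro DERIV_sum DERIV_cmult mixed_monom_derivative[OF \<open>k \<notin> K\<close>])
  qed auto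
  then show ?thesis by (simp add: T_def mixed_series_def)
qed

text \<open>The formula holds at every \<open>l\<close>, which settles the demand for inner
  derivatives in a neighbourhood. Distinctness ensures that each new variable has not been
  differentiated before.\<close>

lemma has_iterated_partial_mixed_series:
  fixes w :: "'n::finite list \<Rightarrow> real"
  assumes w: "\<And>J. \<bar>w J\<bar> \<le> B ^ length J / fact (length J)" and "B \<ge> 0" and "distinct ks"
  shows "has_iterated_partial (mixed_series w {}) ks (mixed_series w (set ks) l) l"
  using \<open>distinct ks\<close>
proof (induction ks arbitrary: l)
  case (Cons k ks)
  then show ?case
    using mixed_series_derivative[OF w \<open>B \<ge> 0\<close>, of k "set ks" l]
    by (auto intro!: exI[of _ "mixed_series w (set ks)"])
qed simp

text \<open>At \<open>0\<close> a factor is \<open>c * 0 ^ (c - 1)\<close>, which is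
  \<open>1\<close> for \<open>c = 1\<close> and \<open>0\<close> otherwise. Only words containing
  every index exactly once survive; all have length \<open>CARD('n)\<close>, so the series collapses
  to one block.\<close>

lemma mixed_series_UNIV_zero:
  fixes w :: "'n::finite list \<Rightarrow> real"
  shows "mixed_series w UNIV 0 = (\<Sum>J\<in>permutations_of_set UNIV. w J)"
proof -
  have monom: "mixed_monom UNIV (count_list J) 0 = (if J \<in> permutations_of_set UNIV then 1 else 0)"
    for J :: "'n list"
  proof (cases "J \<in> permutations_of_set UNIV")
    case True
    then have "count_list J k = 1" for k
      by (auto simp: permutations_of_set_def distinct_count_atmost_1 simp flip: count_mset)
    then show ?thesis using True by (simp add: mixed_monom_def)
  next
    case False
    have "\<exists>k. count_list J k \<noteq> 1"
    proof (rule ccontr)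
      assume "\<nexists>k. count_list J k \<noteq> 1"
      then have J: "count_list J k = 1" for k by auto
      then have "set J = UNIV"
        by (metis UNIV_eq_I count_notin zero_neq_one)
      moreover have "length J = CARD('n)"
        using sum_count_list_UNIV[of J] J by simp
      ultimately have "distinct J" by (simp add: card_distinct)
      with \<open>set J = UNIV\<close> False show False by (simp add: permutations_of_set_def)
    qed
    then obtain k where "count_list J k \<noteq> 1" by blast
    \<comment> \<open>For count \<open>0\<close> the leading factor vanishes, the power being
      \<open>0 ^ 0 = 1\<close>; for counts above \<open>1\<close> the power vanishes.\<close>
    then have "real (count_list J k) * 0 ^ (count_list J k - 1) = 0" by auto
    then have "mixed_monom UNIV (count_list J) 0 = 0"
      unfolding mixed_monom_def by (intro prod_zero) auto
    then show ?thesis using False by simp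
  qed
  have len: "length J = CARD('n)" if "J \<in> permutations_of_set (UNIV :: 'n set)" for J
    using that by (auto simp: permutations_of_set_def distinct_card[symmetric])
  have "mixed_series w UNIV 0 = (\<Sum>m\<in>{CARD('n)}. \<Sum>J | length J = m. w J * mixed_monom UNIV (count_list J) 0)"
    unfolding mixed_series_def
    by (rule suminf_finite) (auto intro!: sum.neutral simp: monom dest: len)
  also have "\<dots> = (\<Sum>J\<in>permutations_of_set UNIV. w J)"
    by (auto intro!: sum.mono_neutral_cong_right finite_lists_length simp: monom len)
  finally show ?thesis .
qed

section \<open>Arrangements of the positions\<close>

text \<open>The head of \<open>J\<close> can be any position \<open>k\<close> in the fibre
  \<open>C\<close> over the head of the list, and the tail arranges \<open>A - {k}\<close>. The set
  \<open>A\<close> is kept general so that the induction can remove positions.\<close>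

lemma card_permutations_of_set_map_eq:
  fixes f :: "'a \<Rightarrow> 'b::finite"
  assumes "finite A" "mset L = image_mset f (mset_set A)"
  shows "card {J \<in> permutations_of_set A. map f J = L} = (\<Prod>j\<in>UNIV. fact (card {k \<in> A. f k = j}))"
  using assms
proof (induction L arbitrary: A)
  case Nil
  then have "A = {}" by (simp add: mset_set_empty_iff)
  then have "{J \<in> permutations_of_set A. map f J = []} = {[]}" by auto
  with \<open>A = {}\<close> show ?case by simp
next
  case (Cons a L)
  define C where "C = {k \<in> A. f k = a}"
  have "finite C" using Cons.prems by (simp add: C_def)
  have "a \<in># image_mset f (mset_set A)" using Cons.prems(2) by (metis list.set_intros(1) set_mset_mset)
  then have "C \<noteq> {}" using Cons.prems(1) by (auto simp: C_def)
  have "card C > 0" using \<open>C \<noteq> {}\<close> \<open>finite C\<close> by (simp add: card_gt_0_iff)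
  define N where "N = (\<lambda>B. \<Prod>j\<in>UNIV. fact (card {k \<in> B. f k = j}) :: nat)"
  have fibre: "card {J \<in> permutations_of_set (A - {k}). map f J = L} = N (A - {k})" if "k \<in> C" for k
    unfolding N_def
  proof (rule Cons.IH)
    have "image_mset f (mset_set (A - {k})) = image_mset f (mset_set A) - {#a#}"
      using Cons.prems(1) that by (auto simp: C_def mset_set_Diff image_mset_Diff)
    also have "\<dots> = mset L"
      unfolding Cons.prems(2)[symmetric] by simp
    finally show "mset L = image_mset f (mset_set (A - {k}))" ..
  qed (use Cons.prems in simp)
  \<comment> \<open>Removing \<open>k\<close> shrinks only the fibre over \<open>a\<close>, so a
    single factorial changes. The relation is stated as a product to avoid division in
    \<open>nat\<close>.\<close>
  have N: "card C * N (A - {k}) = N A" if "k \<in> C" for k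
  proof -
    have "{i \<in> A - {k}. f i = a} = C - {k}" by (auto simp: C_def)
    then have "N (A - {k}) = fact (card (C - {k})) * (\<Prod>j\<in>UNIV - {a}. fact (card {i \<in> A - {k}. f i = j}))"
      unfolding N_def by (subst prod.remove[of _ a]) auto
    also have "(\<Prod>j\<in>UNIV - {a}. fact (card {i \<in> A - {k}. f i = j}))
        = (\<Prod>j\<in>UNIV - {a}. fact (card {i \<in> A. f i = j}) :: nat)"
      using that by (intro prod.cong refl arg_cong[of _ _ "\<lambda>X. fact (card X)"]) (auto simp: C_def)
    also have "card C * (fact (card (C - {k})) * \<dots>) = fact (card C) * \<dots>"
      using that \<open>card C > 0\<close> by (simp add: fact_reduce[of "card C"] card_Diff_singleton)
    also have "\<dots> = N A"
      unfolding N_def by (subst prod.remove[of _ a]) (auto simp: C_def)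
    finally show ?thesis .
  qed
  have "{J \<in> permutations_of_set A. map f J = a # L}
      = (\<Union>k\<in>C. (#) k ` {J \<in> permutations_of_set (A - {k}). map f J = L})"
  proof (intro set_eqI iffI)
    fix J assume J: "J \<in> {J \<in> permutations_of_set A. map f J = a # L}"
    then obtain k J' where "J = k # J'" by (cases J) auto
    with J show "J \<in> (\<Union>k\<in>C. (#) k ` {J \<in> permutations_of_set (A - {k}). map f J = L})"
      by (auto simp: C_def permutations_of_set_def)
  next
    fix J assume "J \<in> (\<Union>k\<in>C. (#) k ` {J \<in> permutations_of_set (A - {k}). map f J = L})"
    then obtain k J' where k: "k \<in> C" and J: "J = k # J'" "J' \<in> permutations_of_set (A - {k})" "map f J' = L"
      by blast
    have "set J = A" "distinct J"
      using permutations_of_setD[OF J(2)] k unfolding J(1) C_def by auto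
    then show "J \<in> {J \<in> permutations_of_set A. map f J = a # L}"
      using k J(1,3) by (simp add: C_def permutations_of_set_def)
  qed
  also have "card \<dots> = (\<Sum>k\<in>C. card ((#) k ` {J \<in> permutations_of_set (A - {k}). map f J = L}))"
    using \<open>finite C\<close> by (intro card_UN_disjoint) auto
  also have "\<dots> = (\<Sum>k\<in>C. N (A - {k}))"
    by (intro sum.cong refl) (simp add: card_image fibre)
  also have "\<dots> = N A"
  proof -
    obtain k0 where "k0 \<in> C" using \<open>C \<noteq> {}\<close> by blast
    \<comment> \<open>Cancelling \<open>card C\<close> shows that every head in \<open>C\<close>
      leaves the same number of tails.\<close>
    have "N (A - {k}) = N (A - {k0})" if "k \<in> C" for k
      using N[OF that] N[OF \<open>k0 \<in> C\<close>] \<open>card C > 0\<close> by (metis mult_left_cancel not_less_zero)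
    then have "(\<Sum>k\<in>C. N (A - {k})) = card C * N (A - {k0})" by simp
    then show ?thesis using N[OF \<open>k0 \<in> C\<close>] by simp
  qed
  finally show ?case by (simp add: N_def)
qed

text \<open>The arrangements are grouped by their image under \<open>map I\<close>; all groups have
  the same size, which factors out.\<close>

lemma sum_permutations_of_set_map:
  fixes I :: "'n::{finite,linorder} \<Rightarrow> 'd::finite" and S :: "'d list \<Rightarrow> real"
  shows "(\<Sum>J\<in>permutations_of_set UNIV. S (map I J))
    = (\<Prod>j\<in>UNIV. fact (card {k. I k = j})) * (\<Sum>L\<in>permutations_of_multiset (mset (tuple I)). S L)"
proof -
  have mset_tuple: "mset (tuple I) = image_mset I (mset_set UNIV)"
    using mset_set_set[of "sorted_list_of_set (UNIV :: 'n set)"] by (simp add: tuple_def)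
  have "mset (map I J) = mset (tuple I)" if "J \<in> permutations_of_set UNIV" for J
    using that mset_set_set[of J] by (simp add: mset_tuple permutations_of_set_def)
  then have img: "map I ` permutations_of_set UNIV \<subseteq> permutations_of_multiset (mset (tuple I))"
    by (auto simp: permutations_of_multiset_def)
  have "(\<Sum>J\<in>permutations_of_set UNIV. S (map I J))
      = (\<Sum>L\<in>permutations_of_multiset (mset (tuple I)).
           \<Sum>J | J \<in> permutations_of_set UNIV \<and> map I J = L. S (map I J))"
    by (rule sum.group[symmetric]) (use img in auto)
  also have "\<dots> = (\<Sum>L\<in>permutations_of_multiset (mset (tuple I)). (\<Prod>j\<in>UNIV. fact (card {k. I k = j})) * S L)"
  proof (rule sum.cong[OF refl])
    fix L assume "L \<in> permutations_of_multiset (mset (tuple I))"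
    then have "mset L = image_mset I (mset_set UNIV)"
      by (simp add: permutations_of_multiset_def mset_tuple)
    then have "card {J \<in> permutations_of_set UNIV. map I J = L} = (\<Prod>j\<in>UNIV. fact (card {k. I k = j}))"
      using card_permutations_of_set_map_eq[of UNIV L I] by simp
    then show "(\<Sum>J | J \<in> permutations_of_set UNIV \<and> map I J = L. S (map I J))
        = (\<Prod>j\<in>UNIV. fact (card {k. I k = j})) * S L"
      by simp
  qed
  finally show ?thesis by (simp add: sum_distrib_left)
qed

text \<open>The product of factorials counts the arrangements of positions behind one permutation of
  the tuple. If \<open>n = 2\<close> and the entries of \<open>I\<close> agree, both arrangements
  give the only permutation and the factor is \<open>2\<close>; for injective \<open>I\<close> it is
  \<open>1\<close>, leaving the coefficient \<open>1 / n!\<close>.\<close>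

theorem proposition2p1:
  fixes I :: "'n::{finite,linorder} \<Rightarrow> 'd::finite"
    and x :: "real \<Rightarrow> real ^ 'd"
    and y :: "real \<Rightarrow> (real, 'n) vec"
  assumes "C1_path x"
    and "\<forall>t\<in>{0..1}. y t = t *\<^sub>R (\<Sum>k\<in>UNIV. axis k 1)"
  shows "has_iterated_partial (\<lambda>l. sig_kernel (coord_path x I) (scale_path l y))
           (sorted_list_of_set UNIV)
           ((\<Prod>j\<in>UNIV. fact (card {k. I k = j})) / fact CARD('n) *
              sig_set x (permutations_of_multiset (mset (tuple I)))) 0
       \<and> (inj I \<longrightarrow>
          has_iterated_partial (\<lambda>l. sig_kernel (coord_path x I) (scale_path l y))
           (sorted_list_of_set UNIV)
           (1 / fact CARD('n) *
              sig_set x (permutations_of_multiset (mset (tuple I)))) 0)"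
proof -
  obtain B where B: "B \<ge> 0" "\<And>js t. 0 \<le> t \<Longrightarrow> t \<le> 1 \<Longrightarrow> \<bar>iter_int x js t\<bar> \<le> B ^ length js"
    using iter_int_bound assms(1) unfolding C1_path_def by blast
  \<comment> \<open>One part of \<open>w\<close> is the signature of the coordinate path, the
    factorial comes from the signature of the scaled linear path.\<close>
  define w where "w = (\<lambda>J. sig x (map I J) / fact (length J))"
  have w: "\<bar>w J\<bar> \<le> B ^ length J / fact (length J)" for J
    using B(2)[of 1 "rev (map I J)"] by (simp add: w_def sig_def divide_right_mono)
  have kernel: "(\<lambda>l. sig_kernel (coord_path x I) (scale_path l y)) = mixed_series w {}"
    by (simp add: fun_eq_iff sig_kernel_def mixed_series_def mixed_monom_empty w_def
        sig_coord_path sig_scale_linear[OF assms(2)])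
  have "mixed_series w UNIV 0 = (\<Sum>J\<in>permutations_of_set UNIV. sig x (map I J) / fact CARD('n))"
    unfolding mixed_series_UNIV_zero
    by (intro sum.cong) (auto simp: w_def permutations_of_set_def distinct_card[symmetric])
  also have "\<dots> = (\<Prod>j\<in>UNIV. fact (card {k. I k = j})) / fact CARD('n) *
      sig_set x (permutations_of_multiset (mset (tuple I)))"
    by (simp add: sum_permutations_of_set_map sig_set_def flip: sum_divide_distrib)
  finally have main: "has_iterated_partial (mixed_series w {}) (sorted_list_of_set UNIV)
      ((\<Prod>j\<in>UNIV. fact (card {k. I k = j})) / fact CARD('n) *
        sig_set x (permutations_of_multiset (mset (tuple I)))) 0"
    using has_iterated_partial_mixed_series[OF w B(1), of "sorted_list_of_set UNIV" 0] by simp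
  \<comment> \<open>Fibres of an injective map have at most one element, and
    \<open>fact 0 = fact 1 = 1\<close>.\<close>
  have "(\<Prod>j\<in>UNIV. fact (card {k. I k = j})) = (1::real)" if "inj I"
  proof (rule prod.neutral, rule ballI)
    fix j
    have "card {k. I k = j} \<le> 1"
      using that by (auto simp: card_le_Suc0_iff_eq inj_def)
    then show "fact (card {k. I k = j}) = (1::real)"
      by (cases "card {k. I k = j}") auto
  qed
  with main show ?thesis unfolding kernel by auto
qed

end
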